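(* Let $A=\begin{pmatrix}A_{11}&A_{12}\\ A_{21}&A_{22}\end{pmatrix}$ be a real symmetric positive definite $N\times N$ matrix, where $A_{11}$ is $m\times m$, $A_{22}$ is $n\times n$, $N=m+n$ and $A_{21}=A_{12}^T$. Let $A_{11}=L_1L_1^T$, $A_{22}=L_2L_2^T$ be Cholesky factorizations, and let $C=L_1^{-1}A_{12}L_2^{-T}$ with singular values $\sigma_1\ge\sigma_2\ge\cdots\ge\sigma_{k}$, $k=\min\{m,n\}$ (all of which are $<1$). Let $C=U\Sigma V^T$ be a full SVD, let $1\le r<k$, let $\Sigma_1=\operatorname{diag}(\sigma_1,\ldots,\sigma_r)$, let $V_1$ consist of the first $r$ columns of $V$, and let $\tau$ satisfy $\sigma_r\ge\tau\ge\sigma_{r+1}$. Let $\tilde D_2$ be the lower triangular Cholesky factor of $I-V_1\Sigma_1^2V_1^T$, i.e. $I-V_1\Sigma_1^2V_1^T=\tilde D_2\tilde D_2^T$, and set $$\tilde L=\begin{pmatrix}L_1&0\\L_2C^T&L_2\end{pmatrix}\begin{pmatrix}I&0\\0&\tilde D_2\end{pmatrix}.$$ Then the eigenvalues of $\tilde L^{-1}A\tilde L^{-T}$ (listed with multiplicity) are $$1-\sigma_{r+1}^2,\ \ldots,\ 1-\sigma_k^2,\ \underbrace{1,\ldots,1}_{N-(k-r)} .$$ Accordingly, $$\|\tilde L^{-1}A\tilde L^{-T}-I\|_2=\sigma_{r+1}^2\le\tau^2,\qquad \kappa(\tilde L^{-1}A\tilde L^{-T})=\frac{1}{1-\sigm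a_{r+1}^2}\le\frac{1}{1-\tau^2}.$$
   Context: All matrices are real. $\|\cdot\|_2$ is the spectral norm and $\kappa(\cdot)$ is the 2-norm condition number. Cholesky factors are lower triangular with positive diagonal entries. In the full SVD $C=U\Sigma V^T$, $U$ ($m\times m$) and $V$ ($n\times n$) are orthogonal and $\Sigma$ is an $m\times n$ rectangular diagonal matrix with the singular values on its diagonal in nonincreasing order. *)

theory Defs
  imports
    Complex_Main
    "HOL-Computational_Algebra.Polynomial"
    "Jordan_Normal_Form.Char_Poly"
    "Jordan_Normal_Form.Gauss_Jordan_Elimination"
begin

definition spd_mat :: "nat \<Rightarrow> real mat \<Rightarrow> bool" where
  "spd_mat n A \<longleftrightarrow> A \<in> carrier_mat n n \<and> transpose_mat A = A \<and>
     (\<forall>x \<in> carrier_vec n. x \<noteq> 0\<^sub>v n \<longrightarrow> x \<bullet> (A *\<^sub>v x) > 0)"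

definition cholesky :: "nat \<Rightarrow> real mat \<Rightarrow> real mat \<Rightarrow> bool" where
  "cholesky n A L \<longleftrightarrow> L \<in> carrier_mat n n \<and>
     (\<forall>i<n. \<forall>j<n. i < j \<longrightarrow> L $$ (i,j) = 0) \<and> (\<forall>i<n. L $$ (i,i) > 0) \<and>
     A = L * transpose_mat L"

(* Unspecified for singular arguments. *)
definition inv_mat :: "real mat \<Rightarrow> real mat" where
  "inv_mat A = the (mat_inverse A)"

(* The library's orthogonal_mat only asks for orthogonal nonzero columns, not orthonormal ones. *)
definition orthonormal_mat :: "nat \<Rightarrow> real mat \<Rightarrow> bool" where
  "orthonormal_mat n U \<longleftrightarrow> U \<in> carrier_mat n n \<and>
     transpose_mat U * U = 1\<^sub>m n \<and> U * transpose_mat U = 1\<^sub>m n"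

(* Full SVD of an m x n matrix. The singular values are s 1, ..., s (min m n), numbered from 1
   although matrix indices start at 0; the values of s outside this range are irrelevant. *)
definition full_svd :: "nat \<Rightarrow> nat \<Rightarrow> real mat \<Rightarrow> real mat \<Rightarrow> (nat \<Rightarrow> real) \<Rightarrow> real mat \<Rightarrow> bool" where
  "full_svd m n C U s V \<longleftrightarrow>
     orthonormal_mat m U \<and> orthonormal_mat n V \<and>
     (\<forall>i \<in> {1..min m n}. s i \<ge> 0) \<and>
     (\<forall>i \<in> {1..min m n}. \<forall>j \<in> {1..min m n}. i \<le> j \<longrightarrow> s j \<le> s i) \<and>
     C = U * Matrix.mat m n (\<lambda>(i,j). if i = j then s (Suc i) else 0) * transpose_mat V"

definition norm2_vec :: "real vec \<Rightarrow> real" where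
  "norm2_vec x = sqrt (x \<bullet> x)"

definition spectral_norm :: "real mat \<Rightarrow> real" where
  "spectral_norm A = (SUP x \<in> {x \<in> carrier_vec (dim_col A). norm2_vec x \<le> 1}. norm2_vec (A *\<^sub>v x))"

definition cond2 :: "real mat \<Rightarrow> real" where
  "cond2 A = spectral_norm A * spectral_norm (inv_mat A)"

(* Eigenvalues with algebraic multiplicity (for a symmetric matrix also the geometric one). *)
definition eigenvalues_mset :: "real mat \<Rightarrow> real multiset" where
  "eigenvalues_mset A = proots (char_poly A)"

end

theory Submission
  imports Defs
begin

text \<open>With \<open>G\<close> the first factor of \<open>Lt\<close> one has \<open>A = G K G\<^sup>T\<close>, where \<open>K\<close> is block diagonal with blocks
  \<open>I\<close> and \<open>I - C\<^sup>T C\<close>; hence \<open>B = D\<^sup>-\<^sup>1 K D\<^sup>-\<^sup>T\<close> with \<open>D\<close> block diagonal with blocks \<open>I\<close> and \<open>D2\<close>. Both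
  \<open>I - C\<^sup>T C\<close> and \<open>D2 D2\<^sup>T\<close> are diagonal in the basis \<open>V\<close>, so \<open>B\<close> is orthogonally similar to the
  diagonal matrix of the quotients of their eigenvalues. These are \<open>1\<close> for the first \<open>r\<close> columns
  of \<open>V\<close> and \<open>1 - \<sigma>\<^sub>i\<^sup>2\<close> for the columns \<open>r < i \<le> k\<close>. Positive definiteness of \<open>K\<close> gives \<open>\<sigma>\<^sub>i < 1\<close>.\<close>

section \<open>Inverses and Cholesky factors\<close>

text \<open>One product equation suffices: taking determinants gives
  \<open>det A \<noteq> 0\<close>, so \<open>mat_inverse\<close> returns a genuine inverse, and
  multiplying \<open>A * B = 1\<close> by it from the left identifies it with
  \<open>B\<close>.\<close>

lemma inv_mat_eqI:
  assumes A: "A \<in> carrier_mat n n" and B: "B \<in> carrier_mat n n" and AB: "A * B = 1\<^sub>m n"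
  shows "inv_mat A = B"
proof -
  have "det A * det B = 1"
    using det_mult[OF A B] AB by simp
  hence "det A \<noteq> 0" by auto
  then obtain X where X: "mat_inverse A = Some X"
    using det_non_zero_imp_unit[OF A, of "()"] mat_inverse(1)[OF A, of "()"] by blast
  from mat_inverse(2)[OF A X] have X': "X * A = 1\<^sub>m n" "X \<in> carrier_mat n n" by auto
  have "X = X * (A * B)" using AB X' by simp
  also have "\<dots> = (X * A) * B" by (rule assoc_mult_mat[symmetric, OF X'(2) A B])
  also have "\<dots> = B" using X' B by simp
  finally show ?thesis using X by (simp add: inv_mat_def)
qed

lemma inv_mat_nonsingular:
  assumes A: "A \<in> carrier_mat n n" and "det A \<noteq> 0"
  shows "inv_mat A \<in> carrier_mat n n" "A * inv_mat A = 1\<^sub>m n" "inv_mat A * A = 1\<^sub>m n"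
proof -
  from assms(2) obtain X where X: "mat_inverse A = Some X"
    using det_non_zero_imp_unit[OF A, of "()"] mat_inverse(1)[OF A, of "()"] by blast
  with mat_inverse(2)[OF A X] show "inv_mat A \<in> carrier_mat n n"
    "A * inv_mat A = 1\<^sub>m n" "inv_mat A * A = 1\<^sub>m n"
    by (auto simp: inv_mat_def)
qed

text \<open>The determinant of a triangular matrix is the product of its diagonal, here positive.
  This makes \<open>inv_mat\<close> of a Cholesky factor meaningful.\<close>

lemma cholesky_det_nonzero:
  assumes "cholesky n A L"
  shows "det L \<noteq> 0"
proof -
  from assms have L: "L \<in> carrier_mat n n"
    and low: "\<And>i j. i < j \<Longrightarrow> j < n \<Longrightarrow> L $$ (i,j) = 0"
    and pos: "\<And>i. i < n \<Longrightarrow> L $$ (i,i) > 0"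
    by (auto simp: cholesky_def)
  have "0 \<notin> set (diag_mat L)" using L pos by (force simp: diag_mat_def)
  thus ?thesis
    using det_lower_triangular[OF low L] by (simp add: prod_list_zero_iff)
qed

section \<open>Orthogonal and diagonal matrices\<close>

lemma orthonormal_matD:
  assumes "orthonormal_mat n Q"
  shows "Q \<in> carrier_mat n n" "transpose_mat Q \<in> carrier_mat n n"
    "transpose_mat Q * Q = 1\<^sub>m n" "Q * transpose_mat Q = 1\<^sub>m n"
  using assms by (auto simp: orthonormal_mat_def)

lemma orthonormal_mat_transpose:
  "orthonormal_mat n Q \<Longrightarrow> orthonormal_mat n (transpose_mat Q)"
  by (auto simp: orthonormal_mat_def)

lemma orthonormal_matI:
  assumes "Q \<in> carrier_mat n n" "Q * transpose_mat Q = 1\<^sub>m n"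
  shows "orthonormal_mat n Q"
  using mat_mult_left_right_inverse[of Q n "transpose_mat Q"] assms
  by (simp add: orthonormal_mat_def)

lemma mat_diag_cong:
  "(\<And>i. i < n \<Longrightarrow> f i = g i) \<Longrightarrow> mat_diag n f = mat_diag n g"
  by (rule eq_matI) (auto simp: mat_diag_def)

lemma transpose_mat_diag [simp]: "transpose_mat (mat_diag n f) = mat_diag n f"
  by (rule eq_matI) (auto simp: mat_diag_def)

lemma norm2_vec_orthonormal:
  assumes Q: "orthonormal_mat n Q" and x: "x \<in> carrier_vec n"
  shows "norm2_vec (Q *\<^sub>v x) = norm2_vec x"
proof -
  note q = orthonormal_matD[OF Q]
  have Qx: "Q *\<^sub>v x \<in> carrier_vec n" using q x by simp
  have "(Q *\<^sub>v x) \<bullet> (Q *\<^sub>v x) = (transpose_mat Q *\<^sub>v (Q *\<^sub>v x)) \<bullet> x"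
    by (rule transpose_vec_mult_scalar[symmetric, OF q(1) x Qx])
  also have "transpose_mat Q *\<^sub>v (Q *\<^sub>v x) = (transpose_mat Q * Q) *\<^sub>v x"
    by (rule assoc_mult_mat_vec[symmetric, OF q(2) q(1) x])
  also have "\<dots> = x" using q x by simp
  finally show ?thesis by (simp add: norm2_vec_def)
qed

lemma mat_diag_mult_vec:
  assumes "x \<in> carrier_vec n"
  shows "mat_diag n f *\<^sub>v x = vec n (\<lambda>i. f i * x $ i)"
proof (rule eq_vecI)
  fix i assume "i < dim_vec (vec n (\<lambda>i. f i * x $ i))"
  hence i: "i < n" by simp
  have "(mat_diag n f *\<^sub>v x) $ i = (\<Sum>j\<in>{0..<n}. (if i = j then f j else 0) * x $ j)"
    using i assms by (auto simp: mat_diag_def scalar_prod_def intro!: sum.cong)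
  also have "\<dots> = (\<Sum>j\<in>{0..<n}. if j = i then f j * x $ j else 0)"
    by (rule sum.cong) auto
  also have "\<dots> = f i * x $ i" using i by simp
  finally show "(mat_diag n f *\<^sub>v x) $ i = vec n (\<lambda>i. f i * x $ i) $ i" using i by simp
qed (auto simp: mat_diag_def)

lemma norm2_vec_mat_diag_le:
  assumes x: "x \<in> carrier_vec n" and c: "c \<ge> 0" and le: "\<And>i. i < n \<Longrightarrow> \<bar>f i\<bar> \<le> c"
  shows "norm2_vec (mat_diag n f *\<^sub>v x) \<le> c * norm2_vec x"
proof -
  have "(\<Sum>i<n. (f i * x $ i)\<^sup>2) \<le> (\<Sum>i<n. c\<^sup>2 * (x $ i)\<^sup>2)"
  proof (rule sum_mono)
    fix i assume "i \<in> {..<n}"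
    hence "\<bar>f i\<bar>\<^sup>2 \<le> c\<^sup>2" using le by (intro power_mono) auto
    thus "(f i * x $ i)\<^sup>2 \<le> c\<^sup>2 * (x $ i)\<^sup>2"
      by (simp add: power_mult_distrib mult_right_mono)
  qed
  hence "sqrt (\<Sum>i<n. (f i * x $ i)\<^sup>2) \<le> sqrt (c\<^sup>2 * (\<Sum>i<n. (x $ i)\<^sup>2))"
    by (simp add: sum_distrib_left)
  thus ?thesis using x c
    by (simp add: norm2_vec_def mat_diag_mult_vec scalar_prod_def real_sqrt_mult
        power2_eq_square atLeast0LessThan)
qed

section \<open>Norm, spectrum and inverse of an orthogonally diagonalized matrix\<close>

text \<open>Orthogonal factors preserve norms, so only the diagonal matters, and it stretches by at
  most \<open>c\<close>. Naming an index \<open>i\<close> of maximal modulus turns the supremum into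
  a maximum, attained at the unit vector \<open>Q e_i\<close>.\<close>

lemma spectral_norm_orthonormal_diag:
  assumes Q: "orthonormal_mat n Q" and i: "i < n" and fi: "\<bar>f i\<bar> = c"
    and le: "\<And>j. j < n \<Longrightarrow> \<bar>f j\<bar> \<le> c"
  shows "spectral_norm (Q * mat_diag n f * transpose_mat Q) = c"
proof -
  note q = orthonormal_matD[OF Q]
  let ?M = "Q * mat_diag n f * transpose_mat Q"
  have c: "c \<ge> 0" using fi by auto
  have dim: "dim_col ?M = n" using q by simp
  have M: "norm2_vec (?M *\<^sub>v x) = norm2_vec (mat_diag n f *\<^sub>v (transpose_mat Q *\<^sub>v x))"
    if x: "x \<in> carrier_vec n" for x
  proof -
    have "?M *\<^sub>v x = Q *\<^sub>v (mat_diag n f *\<^sub>v (transpose_mat Q *\<^sub>v x))"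
      using q x by (simp add: assoc_mult_mat_vec[of _ n n _ n])
    thus ?thesis using norm2_vec_orthonormal[OF Q, of "mat_diag n f *\<^sub>v (transpose_mat Q *\<^sub>v x)"] q x
      by (simp add: mult_mat_vec_carrier[of _ n n])
  qed
  have upper: "norm2_vec (?M *\<^sub>v x) \<le> c" if x: "x \<in> carrier_vec n" "norm2_vec x \<le> 1" for x
  proof -
    have "norm2_vec (?M *\<^sub>v x) \<le> c * norm2_vec (transpose_mat Q *\<^sub>v x)"
      unfolding M[OF x(1)] using q x c le by (intro norm2_vec_mat_diag_le) auto
    also have "\<dots> = c * norm2_vec x"
      using norm2_vec_orthonormal[OF orthonormal_mat_transpose[OF Q] x(1)] by simp
    also have "\<dots> \<le> c" using x c by (simp add: mult_left_le)
    finally show ?thesis .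
  qed
  let ?e = "unit_vec n i :: real vec"
  have ne: "norm2_vec ?e = 1" using i by (simp add: norm2_vec_def)
  have Qe: "Q *\<^sub>v ?e \<in> carrier_vec n" using q by simp
  have nQe: "norm2_vec (Q *\<^sub>v ?e) = 1" using norm2_vec_orthonormal[OF Q, of ?e] ne by simp
  have "transpose_mat Q *\<^sub>v (Q *\<^sub>v ?e) = (transpose_mat Q * Q) *\<^sub>v ?e"
    by (rule assoc_mult_mat_vec[symmetric, OF q(2) q(1)]) simp
  hence "norm2_vec (?M *\<^sub>v (Q *\<^sub>v ?e)) = norm2_vec (mat_diag n f *\<^sub>v ?e)"
    using M[OF Qe] q by simp
  also have "mat_diag n f *\<^sub>v ?e = f i \<cdot>\<^sub>v ?e"
    using i by (auto simp: mat_diag_mult_vec intro!: eq_vecI)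
  also have "norm2_vec (f i \<cdot>\<^sub>v ?e) = c"
    using fi i by (simp add: norm2_vec_def)
  finally have attained: "norm2_vec (?M *\<^sub>v (Q *\<^sub>v ?e)) = c" .
  show ?thesis unfolding spectral_norm_def dim
    by (rule cSup_eq_maximum) (use attained Qe nQe upper in \<open>auto intro!: image_eqI[of _ _ "Q *\<^sub>v ?e"]\<close>)
qed

text \<open>As \<open>Q^T\<close> is the inverse of \<open>Q\<close>, the matrix is similar to
  \<open>mat_diag n f\<close>, whose characteristic polynomial splits into the factors
  \<open>x - f i\<close>; the roots are then counted factor by factor.\<close>

lemma eigenvalues_mset_orthonormal_diag:
  assumes Q: "orthonormal_mat n Q"
  shows "eigenvalues_mset (Q * mat_diag n f * transpose_mat Q) = image_mset f (mset_set {0..<n})"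
proof -
  note q = orthonormal_matD[OF Q]
  have "similar_mat (Q * mat_diag n f * transpose_mat Q) (mat_diag n f)"
    using q by (intro similar_matI[of _ _ Q "transpose_mat Q" n]) auto
  hence "char_poly (Q * mat_diag n f * transpose_mat Q) = char_poly (mat_diag n f)"
    by (rule char_poly_similar)
  also have "\<dots> = (\<Prod>a\<leftarrow>diag_mat (mat_diag n f). [:- a, 1:])"
    by (rule char_poly_upper_triangular[of _ n]) (auto simp: mat_diag_def)
  also have "diag_mat (mat_diag n f) = map f [0..<n]"
    by (auto simp: diag_mat_def mat_diag_def)
  finally have "char_poly (Q * mat_diag n f * transpose_mat Q) = (\<Prod>i\<in>{0..<n}. [:- f i, 1:])"
    using prod.distinct_set_conv_list[of "[0..<n]" "\<lambda>i. [:- f i, 1:]"] by (simp add: o_def)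
  hence "eigenvalues_mset (Q * mat_diag n f * transpose_mat Q) = (\<Sum>i\<in>{0..<n}. {#f i#})"
    by (simp add: eigenvalues_mset_def proots_prod)
  also have "\<dots> = image_mset f (mset_set {0..<n})"
    by (simp add: sum_unfold_sum_mset)
  finally show ?thesis .
qed

text \<open>Subtracting \<open>I = Q Q^T\<close> keeps the basis \<open>Q\<close>, so
  \<open>B - I\<close> falls under the same norm lemma as \<open>B\<close>.\<close>

lemma orthonormal_diag_minus_one:
  assumes Q: "orthonormal_mat n Q"
  shows "Q * mat_diag n f * transpose_mat Q - 1\<^sub>m n = Q * mat_diag n (\<lambda>i. f i - 1) * transpose_mat Q"
proof -
  note q = orthonormal_matD[OF Q]
  have d: "mat_diag n (\<lambda>i. f i - 1) = mat_diag n f - 1\<^sub>m n"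
    by (rule eq_matI) (auto simp: mat_diag_def)
  show ?thesis using q
    by (simp add: d mult_minus_distrib_mat[of _ n n _ n] minus_mult_distrib_mat[of _ n n _ _ n]
      mult_carrier_mat[of _ n n])
qed

lemma inv_mat_orthonormal_diag:
  assumes Q: "orthonormal_mat n Q" and f: "\<And>i. i < n \<Longrightarrow> f i \<noteq> 0"
  shows "inv_mat (Q * mat_diag n f * transpose_mat Q) = Q * mat_diag n (\<lambda>i. 1 / f i) * transpose_mat Q"
proof (rule inv_mat_eqI)
  note q = orthonormal_matD[OF Q]
  let ?D = "mat_diag n f" and ?E = "mat_diag n (\<lambda>i. 1 / f i)"
  have c: "?D \<in> carrier_mat n n" "?E \<in> carrier_mat n n" by auto
  show "Q * ?D * transpose_mat Q \<in> carrier_mat n n" "Q * ?E * transpose_mat Q \<in> carrier_mat n n"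
    using q by auto
  have DE: "?D * ?E = 1\<^sub>m n"
    unfolding mat_diag_diag mat_diag_one[symmetric] using f by (intro mat_diag_cong) simp
  have "Q * ?D * transpose_mat Q * (Q * ?E * transpose_mat Q)
      = Q * (?D * ((transpose_mat Q * Q) * (?E * transpose_mat Q)))"
    using q(1,2) c by (simp add: assoc_mult_mat[of _ n n _ n _ n] mult_carrier_mat[of _ n n])
  also have "\<dots> = Q * ((?D * ?E) * transpose_mat Q)"
    using q c by (simp del: mat_diag_diag add: left_mult_one_mat[of _ n n] assoc_mult_mat[of _ n n _ n _ n] mult_carrier_mat[of _ n n])
  also have "\<dots> = 1\<^sub>m n" unfolding DE using q by simp
  finally show "Q * ?D * transpose_mat Q * (Q * ?E * transpose_mat Q) = 1\<^sub>m n" .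
qed

section \<open>Congruence and simultaneous diagonalization\<close>

text \<open>Evaluate the quadratic form at \<open>x = R^T e_i\<close>. From \<open>R P = I\<close>
  follows \<open>P^T x = e_i\<close>, so the form collapses to \<open>f i\<close>, and
  \<open>x\<close> cannot be zero.\<close>

lemma spd_congruent_diag_pos:
  assumes spd: "spd_mat n (P * mat_diag n f * transpose_mat P)"
    and P: "P \<in> carrier_mat n n" and R: "R \<in> carrier_mat n n" and RP: "R * P = 1\<^sub>m n"
    and i: "i < n"
  shows "f i > 0"
proof -
  let ?e = "unit_vec n i :: real vec" and ?D = "mat_diag n f"
  define x where "x = transpose_mat R *\<^sub>v ?e"
  have x: "x \<in> carrier_vec n" using R by (simp add: x_def)
  have Px: "transpose_mat P *\<^sub>v x = ?e"
  proof -
    have "transpose_mat P *\<^sub>v x = (transpose_mat P * transpose_mat R) *\<^sub>v ?e"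
      unfolding x_def using P R by (simp add: assoc_mult_mat_vec[of _ n n _ n])
    also have "transpose_mat P * transpose_mat R = 1\<^sub>m n"
      using transpose_mult[OF R P] RP by simp
    finally show ?thesis by simp
  qed
  have De: "?D *\<^sub>v ?e \<in> carrier_vec n" by (simp add: mult_mat_vec_carrier[of _ n n])
  have x0: "x \<noteq> 0\<^sub>v n"
  proof
    assume "x = 0\<^sub>v n"
    moreover have "transpose_mat P *\<^sub>v 0\<^sub>v n = 0\<^sub>v n" using P by (intro eq_vecI) auto
    ultimately have "?e = 0\<^sub>v n" using Px by simp
    thus False using i by simp
  qed
  have "0 < x \<bullet> (P * ?D * transpose_mat P *\<^sub>v x)" using spd x x0 by (auto simp: spd_mat_def)
  also have "P * ?D * transpose_mat P *\<^sub>v x = P *\<^sub>v (?D *\<^sub>v ?e)"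
    using P x by (simp add: assoc_mult_mat_vec[of _ n n _ n] Px)
  also have "x \<bullet> \<dots> = (transpose_mat P *\<^sub>v x) \<bullet> (?D *\<^sub>v ?e)"
    by (rule transpose_vec_mult_scalar[symmetric, OF P De x])
  also have "\<dots> = f i" using i by (simp add: Px mat_diag_mult_vec)
  finally show ?thesis .
qed

text \<open>The orthonormal factor is \<open>X V E\<close> with \<open>E\<close> the diagonal matrix of the square roots of \<open>f\<close>;
  its rows are orthonormal because \<open>X V E E V\<^sup>T X\<^sup>T = X D D\<^sup>T X\<^sup>T = I\<close>.\<close>
lemma orthonormal_diagonalization_congruence:
  assumes V: "orthonormal_mat n V" and D: "D \<in> carrier_mat n n" and X: "X \<in> carrier_mat n n"
    and XD: "X * D = 1\<^sub>m n" and DD: "D * transpose_mat D = V * mat_diag n f * transpose_mat V"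
    and f: "\<And>i. i < n \<Longrightarrow> f i > 0"
  obtains Q where "orthonormal_mat n Q"
    "X * (V * mat_diag n g * transpose_mat V) * transpose_mat X
     = Q * mat_diag n (\<lambda>i. g i / f i) * transpose_mat Q"
proof
  note v = orthonormal_matD[OF V]
  let ?E = "mat_diag n (\<lambda>i. sqrt (f i))" and ?H = "mat_diag n (\<lambda>i. g i / f i)"
  let ?Q = "X * V * ?E"
  have E: "?E \<in> carrier_mat n n" "?H \<in> carrier_mat n n" by auto
  have Qc: "?Q \<in> carrier_mat n n" using X v by (simp add: mult_carrier_mat[of _ n n])
  have XV: "X * V \<in> carrier_mat n n" using X v by simp
  have tQ: "transpose_mat ?Q = ?E * (transpose_mat V * transpose_mat X)"
    using X v by (simp add: transpose_mult[of _ n n _ n])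
  have EE: "?E * ?E = mat_diag n f"
    unfolding mat_diag_diag using f by (intro mat_diag_cong) (simp add: less_imp_le)
  \<comment> \<open>Sandwiching the quotient \<open>g / f\<close> between two factors
    \<open>sqrt f\<close> restores \<open>g\<close>; this is why the quotients appear as the new
    diagonal.\<close>
  have EHE: "?E * (?H * ?E) = mat_diag n g"
    unfolding mat_diag_diag
  proof (rule mat_diag_cong)
    fix i assume "i < n"
    hence "sqrt (f i) * sqrt (f i) = f i" "f i \<noteq> 0" using f[of i] by auto
    thus "sqrt (f i) * (g i / f i * sqrt (f i)) = g i" by (simp add: mult.left_commute)
  qed
  note ac = assoc_mult_mat[of _ n n _ n _ n] mult_carrier_mat[of _ n n]
  have tX: "transpose_mat X \<in> carrier_mat n n" and tD: "transpose_mat D \<in> carrier_mat n n"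
    using X D by auto
  have DX: "transpose_mat D * transpose_mat X = 1\<^sub>m n"
    using transpose_mult[OF X D] XD by simp
  have "?Q * transpose_mat ?Q = X * (V * ((?E * ?E) * (transpose_mat V * transpose_mat X)))"
    unfolding tQ using X tX v(1,2) E by (simp add: ac del: mat_diag_diag)
  also have "\<dots> = X * ((V * mat_diag n f * transpose_mat V) * transpose_mat X)"
    unfolding EE using X tX v(1,2) by (simp add: ac)
  also have "\<dots> = (X * D) * (transpose_mat D * transpose_mat X)"
    unfolding DD[symmetric] using X tX D tD by (simp add: ac)
  also have "\<dots> = 1\<^sub>m n" unfolding XD DX by simp
  finally show "orthonormal_mat n ?Q" by (rule orthonormal_matI[OF Qc])
  have "?Q * ?H * transpose_mat ?Q
      = X * (V * ((?E * (?H * ?E)) * (transpose_mat V * transpose_mat X)))"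
    unfolding tQ using X tX v(1,2) E by (simp add: ac del: mat_diag_diag)
  also have "\<dots> = X * (V * mat_diag n g * transpose_mat V) * transpose_mat X"
    unfolding EHE using X tX v(1,2) by (simp add: ac)
  finally show "X * (V * mat_diag n g * transpose_mat V) * transpose_mat X = ?Q * ?H * transpose_mat ?Q" ..
qed

lemma one_minus_orthonormal_diag:
  assumes V: "orthonormal_mat n V"
  shows "1\<^sub>m n - V * mat_diag n f * transpose_mat V = V * mat_diag n (\<lambda>i. 1 - f i) * transpose_mat V"
proof -
  note v = orthonormal_matD[OF V]
  have d: "mat_diag n (\<lambda>i. 1 - f i) = 1\<^sub>m n - mat_diag n f"
    by (rule eq_matI) (auto simp: mat_diag_def)
  show ?thesis using v
    by (simp add: d mult_minus_distrib_mat[of _ n n _ n] minus_mult_distrib_mat[of _ n n _ _ n]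
      mult_carrier_mat[of _ n n])
qed

section \<open>Gram matrix of the SVD and its truncation\<close>

text \<open>The factor \<open>U\<close> cancels in \<open>C^T C\<close>, leaving
  \<open>S^T S\<close> between \<open>V\<close> and \<open>V^T\<close>. If \<open>n > m\<close>, the
  columns of \<open>S\<close> from index \<open>m\<close> on vanish, hence the case
  distinction.\<close>

lemma full_svd_gram:
  assumes "full_svd m n C U s V"
  shows "transpose_mat C * C
    = V * mat_diag n (\<lambda>i. if i < m then (s (Suc i))\<^sup>2 else 0) * transpose_mat V"
proof -
  define S where "S = Matrix.mat m n (\<lambda>(i,j). if i = j then s (Suc i) else 0)"
  have S: "S \<in> carrier_mat m n" by (simp add: S_def)
  from assms have U: "orthonormal_mat m U" and V: "orthonormal_mat n V"
    and C: "C = U * S * transpose_mat V" by (auto simp: full_svd_def S_def)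
  note u = orthonormal_matD[OF U] and v = orthonormal_matD[OF V]
  have tS: "transpose_mat S \<in> carrier_mat n m" using S by simp
  have tC: "transpose_mat C = V * (transpose_mat S * transpose_mat U)"
    unfolding C using S u v by (simp add: transpose_mult[of _ m n _ n] transpose_mult[of _ m m _ n])
  have SS: "transpose_mat S * S = mat_diag n (\<lambda>i. if i < m then (s (Suc i))\<^sup>2 else 0)"
  proof (rule eq_matI)
    fix i j assume "i < dim_row (mat_diag n (\<lambda>i. if i < m then (s (Suc i))\<^sup>2 else 0))"
      and "j < dim_col (mat_diag n (\<lambda>i. if i < m then (s (Suc i))\<^sup>2 else 0))"
    hence ij: "i < n" "j < n" by (auto simp: mat_diag_def)
    have "(transpose_mat S * S) $$ (i,j)
        = (\<Sum>l\<in>{0..<m}. (if l = i then s (Suc l) else 0) * (if l = j then s (Suc l) else 0))"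
      using ij by (simp add: S_def scalar_prod_def)
    \<comment> \<open>A term survives only for \<open>l = i = j\<close>, and the range of
      \<open>l\<close> contains \<open>i\<close> only if \<open>i < m\<close>.\<close>
    also have "\<dots> = (\<Sum>l\<in>{0..<m}. if l = i then (if i = j then (s (Suc i))\<^sup>2 else 0) else 0)"
      by (rule sum.cong) (auto simp: power2_eq_square)
    also have "\<dots> = mat_diag n (\<lambda>i. if i < m then (s (Suc i))\<^sup>2 else 0) $$ (i,j)"
      using ij by (auto simp: mat_diag_def)
    finally show "(transpose_mat S * S) $$ (i,j) = \<dots>" .
  qed (auto simp: mat_diag_def S_def)
  have "transpose_mat C * C = V * (transpose_mat S * (transpose_mat U * U * (S * transpose_mat V)))"
    unfolding tC using S tS u(1,2) v(1,2)
    by (subst C) (simp add: mult_carrier_mat[of _ n m] mult_carrier_mat[of _ m m] mult_carrier_mat[of _ m n]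
      assoc_mult_mat[of _ n n _ m _ n] assoc_mult_mat[of _ n m _ m _ n]
      assoc_mult_mat[of _ m m _ m _ n] assoc_mult_mat[of _ m m _ n _ n])
  also have "\<dots> = V * (transpose_mat S * S) * transpose_mat V"
    using S tS u v by (simp add: assoc_mult_mat[of _ n n _ n _ n] assoc_mult_mat[of _ n m _ n _ n])
  finally show ?thesis unfolding SS .
qed

text \<open>Dropping columns of \<open>V\<close> amounts to padding the diagonal with zeros. In this
  form the truncated matrix shares the full basis \<open>V\<close> with
  \<open>C^T C\<close>.\<close>

lemma leading_columns_diag:
  assumes V: "V \<in> carrier_mat n n" and r: "r \<le> n"
  shows "Matrix.mat n r (\<lambda>(i,j). V $$ (i,j)) * mat_diag r f
      * transpose_mat (Matrix.mat n r (\<lambda>(i,j). V $$ (i,j)))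
    = V * mat_diag n (\<lambda>i. if i < r then f i else 0) * transpose_mat V" (is "?W * _ * _ = _")
proof (rule eq_matI)
  have W: "?W \<in> carrier_mat n r" by simp
  fix i j assume "i < dim_row (V * mat_diag n (\<lambda>i. if i < r then f i else 0) * transpose_mat V)"
    and "j < dim_col (V * mat_diag n (\<lambda>i. if i < r then f i else 0) * transpose_mat V)"
  hence ij: "i < n" "j < n" using V by auto
  have "(?W * mat_diag r f * transpose_mat ?W) $$ (i,j)
      = (\<Sum>l\<in>{0..<r}. V $$ (i,l) * f l * V $$ (j,l))"
    unfolding mat_diag_mult_right[OF W] using ij by (simp add: scalar_prod_def)
  also have "\<dots> = (\<Sum>l\<in>{0..<n}. V $$ (i,l) * (if l < r then f l else 0) * V $$ (j,l))"
    using r by (intro sum.mono_neutral_cong_left) auto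
  also have "\<dots> = (V * mat_diag n (\<lambda>i. if i < r then f i else 0) * transpose_mat V) $$ (i,j)"
    unfolding mat_diag_mult_right[OF V] using ij V by (simp add: scalar_prod_def)
  finally show "(?W * mat_diag r f * transpose_mat ?W) $$ (i,j) = \<dots>" .
qed (use V in auto)

section \<open>Block matrices and the factorization of \<open>A\<close>\<close>

lemma mult_block_diag_one:
  assumes "(X :: 'a :: semiring_1 mat) \<in> carrier_mat n n" "Y \<in> carrier_mat n n"
  shows "four_block_mat (1\<^sub>m m) (0\<^sub>m m n) (0\<^sub>m n m) X * four_block_mat (1\<^sub>m m) (0\<^sub>m m n) (0\<^sub>m n m) Y
    = four_block_mat (1\<^sub>m m) (0\<^sub>m m n) (0\<^sub>m n m) (X * Y)"
  using assms by (subst mult_four_block_mat[of _ m m _ n _ n _ _ m _ n])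
    auto

lemma transpose_block_diag_one:
  assumes "X \<in> carrier_mat n n"
  shows "transpose_mat (four_block_mat (1\<^sub>m m) (0\<^sub>m m n) (0\<^sub>m n m) X)
    = four_block_mat (1\<^sub>m m) (0\<^sub>m m n) (0\<^sub>m n m) (transpose_mat X)"
  using assms by (subst transpose_four_block_mat[of _ m m _ n _ n]) auto

lemma orthonormal_block_diag_one:
  assumes V: "orthonormal_mat n V"
  shows "orthonormal_mat (m + n) (four_block_mat (1\<^sub>m m) (0\<^sub>m m n) (0\<^sub>m n m) V)"
  using orthonormal_matD[OF V]
  by (intro orthonormal_matI) (simp_all add: transpose_block_diag_one mult_block_diag_one)

lemma block_diag_one_orthonormal_diag:
  assumes V: "orthonormal_mat n V"
    and W: "W = four_block_mat (1\<^sub>m m) (0\<^sub>m m n) (0\<^sub>m n m) V"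
  shows "four_block_mat (1\<^sub>m m) (0\<^sub>m m n) (0\<^sub>m n m) (V * mat_diag n f * transpose_mat V)
    = W * mat_diag (m + n) (\<lambda>i. if i < m then 1 else f (i - m)) * transpose_mat W"
proof -
  have "mat_diag (m + n) (\<lambda>i. if i < m then 1 else f (i - m))
      = four_block_mat (1\<^sub>m m) (0\<^sub>m m n) (0\<^sub>m n m) (mat_diag n f)"
    by (rule eq_matI) (auto simp: mat_diag_def)
  thus ?thesis using orthonormal_matD[OF V]
    by (simp add: W transpose_block_diag_one mult_block_diag_one)
qed

text \<open>Scaling by \<open>L1\<close> and \<open>L2\<close> reduces this to block elimination for
  the matrix with blocks \<open>I\<close>, \<open>C\<close>, \<open>C^T\<close>, \<open>I\<close>,
  whose Schur complement is \<open>I - C^T C\<close>. A cancellation occurs only in the lower right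
  corner.\<close>

lemma block_LDL_factorization:
  assumes L1: "L1 \<in> carrier_mat m m" and L2: "L2 \<in> carrier_mat n n"
    and C: "(C :: 'a :: comm_ring_1 mat) \<in> carrier_mat m n"
  defines "G \<equiv> four_block_mat L1 (0\<^sub>m m n) (L2 * transpose_mat C) L2"
  shows "four_block_mat (L1 * transpose_mat L1) (L1 * C * transpose_mat L2)
      (transpose_mat (L1 * C * transpose_mat L2)) (L2 * transpose_mat L2)
    = G * four_block_mat (1\<^sub>m m) (0\<^sub>m m n) (0\<^sub>m n m) (1\<^sub>m n - transpose_mat C * C) * transpose_mat G"
proof -
  let ?X = "transpose_mat C * C"
  have c: "transpose_mat L1 \<in> carrier_mat m m" "transpose_mat L2 \<in> carrier_mat n n"
    "transpose_mat C \<in> carrier_mat n m" "?X \<in> carrier_mat n n"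
    "L2 * transpose_mat C \<in> carrier_mat n m" "C * transpose_mat L2 \<in> carrier_mat m n"
    "L2 * (1\<^sub>m n - ?X) \<in> carrier_mat n n"
    using L1 L2 C by auto
  have tG: "transpose_mat G
      = four_block_mat (transpose_mat L1) (C * transpose_mat L2) (0\<^sub>m n m) (transpose_mat L2)"
    unfolding G_def using L1 L2 C c
    by (subst transpose_four_block_mat[of _ m m _ n _ n]) (auto simp: transpose_mult[of _ n n _ m])
  have GK: "G * four_block_mat (1\<^sub>m m) (0\<^sub>m m n) (0\<^sub>m n m) (1\<^sub>m n - ?X)
      = four_block_mat L1 (0\<^sub>m m n) (L2 * transpose_mat C) (L2 * (1\<^sub>m n - ?X))"
    unfolding G_def using L1 L2 C c
    by (subst mult_four_block_mat[of _ m m _ n _ n _ _ m _ n]) auto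
  have corner: "L2 * transpose_mat C * (C * transpose_mat L2) + L2 * (1\<^sub>m n - ?X) * transpose_mat L2
      = L2 * transpose_mat L2"
  proof -
    have "L2 * transpose_mat C * (C * transpose_mat L2) = L2 * ?X * transpose_mat L2"
      using L2 C c by (simp add: assoc_mult_mat[of _ n n _ m _ n] assoc_mult_mat[of _ n n _ n _ n]
        assoc_mult_mat[of _ n m _ n _ n])
    moreover have "L2 * (1\<^sub>m n - ?X) * transpose_mat L2
        = L2 * transpose_mat L2 - L2 * ?X * transpose_mat L2"
      using L2 c by (simp add: mult_minus_distrib_mat[of _ n n _ n] minus_mult_distrib_mat[of _ n n _ _ n]
        mult_carrier_mat[of _ n n])
    moreover have "L2 * ?X * transpose_mat L2 \<in> carrier_mat n n" "L2 * transpose_mat L2 \<in> carrier_mat n n"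
      using L2 c by auto
    \<comment> \<open>The cancellation \<open>X + (Y - X) = Y\<close> is checked entrywise: it holds
      for matrices only once their dimensions are known to agree.\<close>
    ultimately show ?thesis by (auto intro!: eq_matI)
  qed
  have off: "transpose_mat (L1 * C * transpose_mat L2) = L2 * transpose_mat C * transpose_mat L1"
    using L1 L2 C c by (simp add: transpose_mult[of _ m n _ n] transpose_mult[of _ m m _ n]
      assoc_mult_mat[of _ n n _ m _ m])
  show ?thesis unfolding GK tG
    by (subst mult_four_block_mat[of _ m m _ n _ n _ _ m _ n])
      (use L1 L2 C c corner off in \<open>auto simp: assoc_mult_mat[of _ m m _ n _ n]\<close>)
qed

section \<open>The preconditioned matrix\<close>

theorem theorem2p2:
  fixes m n N k r :: nat
    and A A11 A12 A21 A22 L1 L2 C U V V1 Sigma1 D2 Lt B :: "real mat"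
    and \<sigma> :: "nat \<Rightarrow> real" and \<tau> :: real
  assumes "N = m + n"
    and "A11 \<in> carrier_mat m m" and "A12 \<in> carrier_mat m n"
    and "A21 \<in> carrier_mat n m" and "A22 \<in> carrier_mat n n"
    and "A = four_block_mat A11 A12 A21 A22"
    and "A21 = transpose_mat A12"
    and "spd_mat N A"
    and "cholesky m A11 L1" and "cholesky n A22 L2"
    and "C = inv_mat L1 * A12 * transpose_mat (inv_mat L2)"
    and "k = min m n"
    and "full_svd m n C U \<sigma> V"
    and "1 \<le> r" and "r < k"
    and "Sigma1 = mat_diag r (\<lambda>i. \<sigma> (Suc i))"
    and "V1 = Matrix.mat n r (\<lambda>(i,j). V $$ (i,j))"
    and "\<tau> \<le> \<sigma> r" and "\<sigma> (r + 1) \<le> \<tau>"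
    and "cholesky n (1\<^sub>m n - V1 * (Sigma1 ^\<^sub>m 2) * transpose_mat V1) D2"
    and "Lt = four_block_mat L1 (0\<^sub>m m n) (L2 * transpose_mat C) L2
              * four_block_mat (1\<^sub>m m) (0\<^sub>m m n) (0\<^sub>m n m) D2"
    and "B = inv_mat Lt * A * transpose_mat (inv_mat Lt)"
  shows "(\<forall>i \<in> {1..k}. \<sigma> i < 1) \<and>
    eigenvalues_mset B =
      image_mset (\<lambda>i. 1 - (\<sigma> i)\<^sup>2) (mset_set {r+1..k}) + replicate_mset (N - (k - r)) 1 \<and>
    spectral_norm (B - 1\<^sub>m N) = (\<sigma> (r + 1))\<^sup>2 \<and> (\<sigma> (r + 1))\<^sup>2 \<le> \<tau>\<^sup>2 \<and>
    cond2 B = 1 / (1 - (\<sigma> (r + 1))\<^sup>2) \<and>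
    1 / (1 - (\<sigma> (r + 1))\<^sup>2) \<le> 1 / (1 - \<tau>\<^sup>2)"
proof -
  have L1: "L1 \<in> carrier_mat m m" "A11 = L1 * transpose_mat L1"
    and L2: "L2 \<in> carrier_mat n n" "A22 = L2 * transpose_mat L2"
    and D2: "D2 \<in> carrier_mat n n"
    using \<open>cholesky m A11 L1\<close> \<open>cholesky n A22 L2\<close> \<open>cholesky n _ D2\<close> by (auto simp: cholesky_def)
  note det1 = cholesky_det_nonzero[OF \<open>cholesky m A11 L1\<close>]
    and det2 = cholesky_det_nonzero[OF \<open>cholesky n A22 L2\<close>]
    and detD2 = cholesky_det_nonzero[OF \<open>cholesky n _ D2\<close>]
  note iL1 = inv_mat_nonsingular[OF L1(1) det1] and iL2 = inv_mat_nonsingular[OF L2(1) det2]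
  have A12: "A12 \<in> carrier_mat m n" by fact
  have C: "C \<in> carrier_mat m n" using iL1 iL2 A12 \<open>C = _\<close> by auto
  have V: "orthonormal_mat n V" and \<sigma>_nonneg: "\<And>i. i \<in> {1..k} \<Longrightarrow> 0 \<le> \<sigma> i"
    and \<sigma>_mono: "\<And>i j. \<lbrakk>i \<in> {1..k}; j \<in> {1..k}; i \<le> j\<rbrakk> \<Longrightarrow> \<sigma> j \<le> \<sigma> i"
    using \<open>full_svd m n C U \<sigma> V\<close> \<open>k = min m n\<close> by (auto simp: full_svd_def)
  note v = orthonormal_matD[OF V]

  \<comment> \<open>The definition of \<open>C\<close> is solved for \<open>A12\<close>, so that the
    off-diagonal block matches the block factorization.\<close>
  have "L1 * C * transpose_mat L2 = (L1 * inv_mat L1) * A12 * transpose_mat (L2 * inv_mat L2)"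
    using \<open>C = _\<close> L1(1) L2(1) A12 iL1(1) iL2(1)
    by (simp add: transpose_mult[of _ n n _ n] assoc_mult_mat[of _ m m _ m _ n]
        assoc_mult_mat[of _ m m _ n _ n] assoc_mult_mat[of _ m n _ n _ n])
  hence A12_eq: "L1 * C * transpose_mat L2 = A12" using A12 iL1 iL2 by simp

  \<comment> \<open>These are the eigenvalues of \<open>I - C^T C\<close> and of
    \<open>D2 D2^T\<close> in the basis \<open>V\<close>. Columns count from 0 and singular values
    from 1, hence \<open>Suc i\<close>; columns from \<open>k\<close> on carry the value 1 in
    both.\<close>
  define f where "f i = (if i < k then 1 - (\<sigma> (Suc i))\<^sup>2 else 1)" for i
  define f1 where "f1 i = (if i < r then 1 - (\<sigma> (Suc i))\<^sup>2 else 1)" for i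
  define W where "W = four_block_mat (1\<^sub>m m) (0\<^sub>m m n) (0\<^sub>m n m) V"
  define G where "G = four_block_mat L1 (0\<^sub>m m n) (L2 * transpose_mat C) L2"
  define D where "D = four_block_mat (1\<^sub>m m) (0\<^sub>m m n) (0\<^sub>m n m) D2"
  have W: "orthonormal_mat N W" unfolding W_def \<open>N = m + n\<close> by (rule orthonormal_block_diag_one[OF V])
  note w = orthonormal_matD[OF W]
  have G: "G \<in> carrier_mat N N" and D: "D \<in> carrier_mat N N"
    using L1 L2 C D2 \<open>N = m + n\<close> by (auto simp: G_def D_def)
  have detG: "det G \<noteq> 0" unfolding G_def using det1 det2 L1 L2 C
    by (subst det_four_block_mat_upper_right_zero[of _ m _ n]) auto
  have detD: "det D \<noteq> 0" unfolding D_def using detD2 D2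
    by (subst det_four_block_mat_upper_right_zero[of _ m _ n]) auto
  note iG = inv_mat_nonsingular[OF G detG] and iD = inv_mat_nonsingular[OF D detD]
  note ac = assoc_mult_mat[of _ N N _ N _ N] mult_carrier_mat[of _ N N]

  \<comment> \<open>The Gram matrix distinguishes cases by \<open>i < m\<close>; for
    \<open>i < n\<close> this agrees with \<open>i < k\<close>.\<close>
  have "1\<^sub>m n - transpose_mat C * C = V * mat_diag n f * transpose_mat V"
    unfolding full_svd_gram[OF \<open>full_svd m n C U \<sigma> V\<close>] one_minus_orthonormal_diag[OF V]
    by (rule arg_cong[where f = "\<lambda>M. V * M * transpose_mat V"], rule eq_matI)
      (auto simp: mat_diag_def f_def \<open>k = min m n\<close>)
  hence K: "four_block_mat (1\<^sub>m m) (0\<^sub>m m n) (0\<^sub>m n m) (1\<^sub>m n - transpose_mat C * C)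
      = W * mat_diag N (\<lambda>i. if i < m then 1 else f (i - m)) * transpose_mat W"
    using block_diag_one_orthonormal_diag[OF V W_def, of f] by (simp add: \<open>N = m + n\<close>)
  let ?Kd = "mat_diag N (\<lambda>i. if i < m then 1 else f (i - m))"
  have A_G: "A = G * (W * ?Kd * transpose_mat W) * transpose_mat G"
    using block_LDL_factorization[OF L1(1) L2(1) C] \<open>A = four_block_mat _ _ _ _\<close> L1 L2 A12_eq
      \<open>A21 = _\<close> unfolding G_def[symmetric] K by simp

  \<comment> \<open>Absorbing \<open>W\<close> into \<open>G\<close> exhibits \<open>A\<close> as
    congruent to a diagonal matrix, so that positive definiteness becomes positivity of the
    diagonal.\<close>
  have A_GW: "A = (G * W) * ?Kd * transpose_mat (G * W)"
    unfolding A_G using G w(1,2) by (simp add: transpose_mult[of _ N N _ N] ac)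
  have "(transpose_mat W * inv_mat G) * (G * W) = transpose_mat W * ((inv_mat G * G) * W)"
    using iG(1) G w(1,2) by (simp add: ac)
  hence GW_inv: "(transpose_mat W * inv_mat G) * (G * W) = 1\<^sub>m N" using iG w by simp
  have f_pos: "f i > 0" if "i < n" for i
  proof -
    \<comment> \<open>Entry \<open>i\<close> of the second block sits at position
      \<open>m + i\<close>.\<close>
    have "(\<lambda>i. if i < m then 1 else f (i - m)) (m + i) > 0"
      by (rule spd_congruent_diag_pos[OF _ _ _ GW_inv, where f = "\<lambda>i. if i < m then 1 else f (i - m)"])
        (use \<open>spd_mat N A\<close> A_GW G w iG that \<open>N = m + n\<close> in auto)
    thus ?thesis by simp
  qed
  have \<sigma>_less: "\<sigma> i < 1" if "i \<in> {1..k}" for i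
  proof -
    have "(\<sigma> i)\<^sup>2 < 1\<^sup>2"
      using f_pos[of "i - 1"] that \<open>k = min m n\<close> by (cases i) (auto simp: f_def split: if_splits)
    thus ?thesis by (rule power_less_imp_less_base) simp
  qed

  have "Sigma1 ^\<^sub>m 2 = mat_diag r (\<lambda>i. (\<sigma> (Suc i))\<^sup>2)"
    using \<open>Sigma1 = _\<close> mat_diag_dim[of r "\<lambda>i. \<sigma> (Suc i)"]
    by (simp add: numeral_2_eq_2 power2_eq_square)
  hence "1\<^sub>m n - V1 * (Sigma1 ^\<^sub>m 2) * transpose_mat V1 = V * mat_diag n f1 * transpose_mat V"
    unfolding \<open>V1 = _\<close> using leading_columns_diag[OF v(1)] \<open>r < k\<close> \<open>k = min m n\<close>
    by (simp add: one_minus_orthonormal_diag[OF V] f1_def[abs_def] if_distrib cong: if_cong)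
  hence "D2 * transpose_mat D2 = V * mat_diag n f1 * transpose_mat V"
    using \<open>cholesky n _ D2\<close> by (simp add: cholesky_def)
  hence DD: "D * transpose_mat D = W * mat_diag N (\<lambda>i. if i < m then 1 else f1 (i - m)) * transpose_mat W"
    using block_diag_one_orthonormal_diag[OF V W_def, of f1] D2
    by (simp add: D_def transpose_block_diag_one mult_block_diag_one \<open>N = m + n\<close>)

  \<comment> \<open>Truncation only replaces entries by 1: as \<open>r < k\<close>, each
    \<open>f1 i\<close> is either \<open>f i\<close> or 1.\<close>
  have f1_pos: "f1 i > 0" if "i < n" for i
    using f_pos[OF that] \<open>r < k\<close> by (auto simp: f_def f1_def)
  have f1_block_pos: "(if i < m then 1 else f1 (i - m)) > 0" if "i < N" for i
    using f1_pos that \<open>N = m + n\<close> by auto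
  obtain Q where Q: "orthonormal_mat N Q"
    and Q_eq: "inv_mat D * (W * ?Kd * transpose_mat W) * transpose_mat (inv_mat D)
      = Q * mat_diag N (\<lambda>i. (if i < m then 1 else f (i - m)) / (if i < m then 1 else f1 (i - m)))
        * transpose_mat Q"
    using orthonormal_diagonalization_congruence[OF W D iD(1) iD(3) DD f1_block_pos,
        of "\<lambda>i. if i < m then 1 else f (i - m)"] by blast
  \<comment> \<open>The quotient of \<open>f\<close> by \<open>f1\<close>: for the first
    \<open>r\<close> columns of \<open>V\<close> both agree, for the next \<open>k - r\<close> the
    denominator is 1, and beyond these both are 1. Everything is shifted by the \<open>m\<close>
    ones of the identity block.\<close>
  define h where "h i = (if m + r \<le> i \<and> i < m + k then 1 - (\<sigma> (Suc (i - m)))\<^sup>2 else 1)" for i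
  have h_eq: "mat_diag N (\<lambda>i. (if i < m then 1 else f (i - m)) / (if i < m then 1 else f1 (i - m)))
      = mat_diag N h"
  proof (rule mat_diag_cong)
    fix i assume "i < N"
    \<comment> \<open>For \<open>m \<le> i < m + r\<close> the quotient is a number divided by
      itself, which is 1 only for a nonzero denominator.\<close>
    hence "i < m \<or> f1 (i - m) > 0" using f1_pos[of "i - m"] \<open>N = m + n\<close> by linarith
    thus "(if i < m then 1 else f (i - m)) / (if i < m then 1 else f1 (i - m)) = h i"
      using \<open>r < k\<close> by (auto simp: f_def f1_def h_def)
  qed

  have "Lt = G * D" using \<open>Lt = _\<close> by (simp add: G_def D_def)
  moreover have "inv_mat (G * D) = inv_mat D * inv_mat G"
  proof (rule inv_mat_eqI)
    have "G * D * (inv_mat D * inv_mat G) = G * ((D * inv_mat D) * inv_mat G)"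
      using G D iG(1) iD(1) by (simp add: ac)
    thus "G * D * (inv_mat D * inv_mat G) = 1\<^sub>m N" using G iG iD by simp
  qed (use G D iG iD in auto)
  ultimately have iLt: "inv_mat Lt = inv_mat D * inv_mat G" by simp
  let ?K = "W * ?Kd * transpose_mat W"
  have Kc: "?K \<in> carrier_mat N N" using w by (simp add: mult_carrier_mat[of _ N N])
  have GG: "transpose_mat G * transpose_mat (inv_mat G) = 1\<^sub>m N"
    using transpose_mult[OF iG(1) G] iG(3) by simp
  \<comment> \<open>Regrouping isolates \<open>inv_mat G * G\<close> and its transpose, so
    \<open>G\<close> disappears and only the congruence by \<open>inv_mat D\<close> remains.\<close>
  have "B = inv_mat D * ((inv_mat G * G) * (?K * ((transpose_mat G * transpose_mat (inv_mat G)) * transpose_mat (inv_mat D))))"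
    unfolding \<open>B = _\<close> iLt A_G using Kc G iG(1) iD(1)
    by (simp add: transpose_mult[of _ N N _ N] ac del: mat_diag_dim)
  also have "\<dots> = inv_mat D * ?K * transpose_mat (inv_mat D)"
    unfolding GG iG(3) using Kc iD(1)
    by (simp add: ac left_mult_one_mat[of _ N N] del: mat_diag_dim)
  finally have B: "B = Q * mat_diag N h * transpose_mat Q" unfolding Q_eq h_eq .

  have bounds: "0 \<le> (\<sigma> (Suc i))\<^sup>2" "(\<sigma> (Suc i))\<^sup>2 \<le> (\<sigma> (r + 1))\<^sup>2" if "r \<le> i" "i < k" for i
    using \<sigma>_mono[of "r + 1" "Suc i"] \<sigma>_nonneg[of "Suc i"] that by (auto intro!: power_mono)
  have r1: "r + 1 \<in> {1..k}" "r \<in> {1..k}" using \<open>r < k\<close> \<open>1 \<le> r\<close> by auto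
  have lt1: "(\<sigma> (r + 1))\<^sup>2 < 1"
    using \<sigma>_less[OF r1(1)] \<sigma>_nonneg[OF r1(1)] by (simp add: power_less_one_iff abs_square_less_1)
  have h_le: "h i \<le> 1" "1 - (\<sigma> (r + 1))\<^sup>2 \<le> h i" for i
    using bounds[of "i - m"] by (auto simp: h_def)
  have h_pos: "0 < h i" for i using h_le(2)[of i] lt1 by linarith
  \<comment> \<open>Position \<open>m + r\<close> carries the smallest eigenvalue and thus the
    largest deviation from 1. Position 0 lies in the identity block, nonempty because
    \<open>r < k\<close> forces \<open>m > 0\<close>, and carries the largest eigenvalue 1.\<close>
  have mr: "m + r < N" "0 < m" "0 < N" using \<open>r < k\<close> \<open>k = min m n\<close> \<open>N = m + n\<close> by auto
  have h_mr: "h (m + r) = 1 - (\<sigma> (r + 1))\<^sup>2" using \<open>r < k\<close> by (simp add: h_def)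
  have h_0: "h 0 = 1" using \<open>0 < m\<close> by (simp add: h_def)

  have "spectral_norm (B - 1\<^sub>m N) = (\<sigma> (r + 1))\<^sup>2"
    unfolding B orthonormal_diag_minus_one[OF Q]
  proof (rule spectral_norm_orthonormal_diag[OF Q mr(1)])
    fix j show "\<bar>h j - 1\<bar> \<le> (\<sigma> (r + 1))\<^sup>2" using h_le[of j] by (simp add: abs_if)
  qed (simp add: h_mr)
  moreover have "spectral_norm B = 1"
    unfolding B using h_le(1) h_pos h_0
    by (intro spectral_norm_orthonormal_diag[OF Q mr(3)]) (auto simp: abs_of_pos)
  moreover have "spectral_norm (inv_mat B) = 1 / (1 - (\<sigma> (r + 1))\<^sup>2)"
  proof -
    have "inv_mat B = Q * mat_diag N (\<lambda>i. 1 / h i) * transpose_mat Q"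
      unfolding B using h_pos by (intro inv_mat_orthonormal_diag[OF Q]) (simp add: less_imp_neq[symmetric])
    moreover have "spectral_norm (Q * mat_diag N (\<lambda>i. 1 / h i) * transpose_mat Q) = 1 / (1 - (\<sigma> (r + 1))\<^sup>2)"
    proof (rule spectral_norm_orthonormal_diag[OF Q mr(1)])
      show "\<bar>1 / h (m + r)\<bar> = 1 / (1 - (\<sigma> (r + 1))\<^sup>2)" using lt1 by (simp add: h_mr)
      fix j show "\<bar>1 / h j\<bar> \<le> 1 / (1 - (\<sigma> (r + 1))\<^sup>2)"
        using h_pos[of j] h_le(2)[of j] lt1 by (simp add: abs_of_pos frac_le)
    qed
    ultimately show ?thesis by simp
  qed
  moreover have "eigenvalues_mset B =
      image_mset (\<lambda>i. 1 - (\<sigma> i)\<^sup>2) (mset_set {r+1..k}) + replicate_mset (N - (k - r)) 1"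
  proof -
    \<comment> \<open>These \<open>k - r\<close> positions yield the eigenvalues 1 - \<sigma>^2 of
      the claim; on the complement in \<open>{0..<N}\<close> the function \<open>h\<close> is
      constantly 1, which gives the count \<open>N - (k - r)\<close>.\<close>
    let ?S = "{m + r..<m + k}"
    have S: "?S \<subseteq> {0..<N}" using \<open>k = min m n\<close> \<open>N = m + n\<close> by auto
    have "{r+1..k} = (\<lambda>i. Suc (i - m)) ` ?S"
    proof (intro equalityI subsetI)
      fix i assume "i \<in> {r+1..k}"
      \<comment> \<open>The singular value numbered \<open>i\<close> from 1 belongs to position
        \<open>m + i - 1\<close> counted from 0.\<close>
      thus "i \<in> (\<lambda>i. Suc (i - m)) ` ?S" by (intro image_eqI[of _ _ "m + i - 1"]) auto
    qed auto
    moreover have "inj_on (\<lambda>i. Suc (i - m)) ?S" by (auto simp: inj_on_def)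
    ultimately have "mset_set {r+1..k} = image_mset (\<lambda>i. Suc (i - m)) (mset_set ?S)"
      by (simp add: image_mset_mset_set)
    hence "image_mset (\<lambda>i. 1 - (\<sigma> i)\<^sup>2) (mset_set {r+1..k}) = image_mset h (mset_set ?S)"
      by (auto simp: multiset.map_comp h_def intro!: image_mset_cong)
    moreover have "image_mset h (mset_set ({0..<N} - ?S)) = replicate_mset (N - (k - r)) 1"
    proof -
      have "image_mset h (mset_set ({0..<N} - ?S)) = image_mset (\<lambda>_. 1) (mset_set ({0..<N} - ?S))"
        by (rule image_mset_cong) (auto simp: h_def)
      thus ?thesis using S by (simp add: image_mset_const_eq card_Diff_subset)
    qed
    moreover have "mset_set {0..<N} = mset_set ?S + mset_set ({0..<N} - ?S)"
      using mset_set_Union[of ?S "{0..<N} - ?S"] S by (simp add: Un_absorb1)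
    ultimately show ?thesis unfolding B eigenvalues_mset_orthonormal_diag[OF Q] by simp
  qed
  moreover have "(\<sigma> (r + 1))\<^sup>2 \<le> \<tau>\<^sup>2"
    using \<open>\<sigma> (r + 1) \<le> \<tau>\<close> \<sigma>_nonneg[OF r1(1)] by (rule power_mono)
  \<comment> \<open>Comparing the reciprocals requires \<open>1 - \<tau>^2\<close> to be positive.
    The upper bound \<tau> \<le> \<sigma> r < 1 provides this.\<close>
  moreover have "\<tau>\<^sup>2 < 1"
    using \<sigma>_less[OF r1(2)] \<sigma>_nonneg[OF r1(1)] \<open>\<sigma> (r + 1) \<le> \<tau>\<close> \<open>\<tau> \<le> \<sigma> r\<close>
    by (simp add: abs_square_less_1)
  ultimately show ?thesis using \<sigma>_less by (auto simp: cond2_def frac_le)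
qed

end
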